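(* Let $\Gamma$ be a smooth plane curve whose end points are unit distance apart and which is tangent, to all orders, at the end points to the $x$-axis. Let $Z(\Gamma)=n$ (a finite number). Then there is no smooth plane curve $\gamma$ whose end points are unit distance apart and which is tangent, to all orders, at the end points to the $x$-axis, such that $T^{n+1}(\gamma)=\Gamma$.
   Context: Curves are smooth, regular, oriented plane curves. "Tangent to all orders to the $x$-axis at the end points, which are unit distance apart" means that, for the arc length parametrization $\gamma:[0,L]\to\mathbb{R}^2$, there is $a\in\mathbb{R}$ with $\gamma(0)=(a,0)$, $\gamma(L)=(a+1,0)$, $\gamma'(0)=\gamma'(L)=(1,0)$ (the $x$-axis is oriented to the right), and all derivatives of $\gamma$ of order $\ge2$ vanish at $0$ and $L$. For such a curve $\gamma$ with arc length parameter $t$, $T(\gamma)$ is the curve $t\mapsto\gamma(t)+\gamma'(t)$, i.e. the locus of endpoints of the unit tangent segments to $\gamma$ (front wheel track of a bicycle of length $1$ with rear wheel track $\gamma$); it is again a curve of the same kind, with end points shifted by $(1,0)$, and can be reparametrized by arc length, so that $T$ can be iterated. $Z$ of a curve is the number of its intersection points with the $x$-axis, end points excluded, counted by parameter values in the open parameter interval. *)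

theory Defs
  imports "HOL-Analysis.Analysis" "HOL-Library.Extended_Nat" "HOL-Library.FuncSet"
begin

text \<open>
  An oriented plane curve is represented by its arc length parametrization on \<open>{0..L}\<close>.
  The parametrization is required to be extensional (see \<open>smooth_curve\<close>), so that equality
  of values of this type is equality of the parametrizations on \<open>{0..L}\<close>.
\<close>

datatype plane_curve = Curve (len: real) (param: "real \<Rightarrow> real^2")

text \<open>Derivatives at the two end points of \<open>{0..L}\<close> are one-sided.\<close>

fun nth_deriv_on :: "real \<Rightarrow> nat \<Rightarrow> (real \<Rightarrow> real^2) \<Rightarrow> real \<Rightarrow> real^2" where
  "nth_deriv_on L 0 c = c"
| "nth_deriv_on L (Suc k) c =
     (\<lambda>t. vector_derivative (nth_deriv_on L k c) (at t within {0..L}))"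

definition smooth_on_interval :: "real \<Rightarrow> (real \<Rightarrow> real^2) \<Rightarrow> bool" where
  "smooth_on_interval L c \<longleftrightarrow>
     (\<forall>k. \<forall>t\<in>{0..L}. nth_deriv_on L k c differentiable (at t within {0..L}))"

definition smooth_curve :: "plane_curve \<Rightarrow> bool" where
  "smooth_curve \<gamma> \<longleftrightarrow>
     0 < len \<gamma> \<and> param \<gamma> \<in> extensional {0..len \<gamma>} \<and>
     smooth_on_interval (len \<gamma>) (param \<gamma>) \<and>
     (\<forall>t\<in>{0..len \<gamma>}. norm (nth_deriv_on (len \<gamma>) 1 (param \<gamma>) t) = 1)"

definition flat_unit_ends :: "plane_curve \<Rightarrow> bool" where
  "flat_unit_ends \<gamma> \<longleftrightarrow>
     (\<exists>a. param \<gamma> 0 = vector [a, 0] \<and> param \<gamma> (len \<gamma>) = vector [a + 1, 0]) \<and>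
     (\<forall>t\<in>{0, len \<gamma>}.
        nth_deriv_on (len \<gamma>) 1 (param \<gamma>) t = vector [1, 0] \<and>
        (\<forall>k\<ge>2. nth_deriv_on (len \<gamma>) k (param \<gamma>) t = 0))"

definition arc_length :: "real \<Rightarrow> (real \<Rightarrow> real^2) \<Rightarrow> real \<Rightarrow> real" where
  "arc_length L c t = integral {0..t} (\<lambda>u. norm (nth_deriv_on L 1 c u))"

definition arc_length_reparam :: "real \<Rightarrow> (real \<Rightarrow> real^2) \<Rightarrow> plane_curve" where
  "arc_length_reparam L c =
     Curve (arc_length L c L)
       (restrict (\<lambda>s. c (the_inv_into {0..L} (arc_length L c) s)) {0..arc_length L c L})"

text \<open>
  \<open>T \<gamma>\<close> is the locus \<open>t \<mapsto> \<gamma>(t) + \<gamma>'(t)\<close> of the end points of the unit tangent segments.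
  For a smooth \<open>\<gamma>\<close> its speed is at least 1 because \<open>\<gamma>'\<close> is a unit vector orthogonal
  to \<open>\<gamma>''\<close>, so \<open>arc_length\<close> is invertible on the parameter interval.
\<close>

definition T :: "plane_curve \<Rightarrow> plane_curve" where
  "T \<gamma> = arc_length_reparam (len \<gamma>)
           (\<lambda>t. param \<gamma> t + nth_deriv_on (len \<gamma>) 1 (param \<gamma>) t)"

definition axis_params :: "plane_curve \<Rightarrow> real set" where
  "axis_params \<gamma> = {t \<in> {0<..<len \<gamma>}. param \<gamma> t $ 2 = 0}"

definition Z :: "plane_curve \<Rightarrow> enat" where
  "Z \<gamma> = (if finite (axis_params \<gamma>) then enat (card (axis_params \<gamma>)) else \<infinity>)"

end

theory Submission
  imports Defs
begin

text \<open>
  Let \<open>y\<close> be the second coordinate of \<open>\<gamma>\<close> as a function of arc length, so that \<open>T \<gamma>\<close> has second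
  coordinate \<open>y + y'\<close>, which is \<open>exp (-t)\<close> times the derivative of \<open>exp t * y t\<close>. The function
  \<open>exp t * y t\<close> vanishes at both end points and at the interior zeros of \<open>y\<close>, so by Rolle's
  theorem \<open>Z (T \<gamma>) \<ge> Z \<gamma> + 1\<close>. Iterating, \<open>Z (T\<^sup>n\<^sup>+\<^sup>1 \<gamma>) \<ge> n + 1\<close>. Along the iteration one only
  has to carry smoothness, unit speed, and the vanishing of all derivatives of \<open>y\<close> at the end
  points; the last property passes to \<open>T \<gamma>\<close> because it survives differentiation and
  reparametrization.
\<close>

section \<open>Differentiability of finite order with vanishing derivatives\<close>

text \<open>Encodes C^k on \<open>S\<close> with all derivatives of orders 0 to k zero on
  \<open>E\<close>; \<open>E = {}\<close> gives plain C^k. The derivative is existentially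
  quantified at each order, so closure proofs can supply it as an explicit formula. Taken within
  \<open>S\<close>, it is one-sided at the ends of an interval.\<close>

primrec Ck_vanishing ::
    "real set \<Rightarrow> real set \<Rightarrow> nat \<Rightarrow> (real \<Rightarrow> 'a::real_normed_vector) \<Rightarrow> bool" where
  "Ck_vanishing S E 0 f \<longleftrightarrow> continuous_on S f \<and> (\<forall>t\<in>E. f t = 0)"
| "Ck_vanishing S E (Suc k) f \<longleftrightarrow>
     (\<exists>f'. (\<forall>t\<in>S. (f has_vector_derivative f' t) (at t within S)) \<and>
           (\<forall>t\<in>E. f t = 0) \<and> Ck_vanishing S E k f')"

lemma Ck_vanishing_zero: "Ck_vanishing S E k f \<Longrightarrow> t \<in> E \<Longrightarrow> f t = 0"
  by (cases k) auto

lemma Ck_vanishing_continuous_on: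
  assumes "Ck_vanishing S E k f"
  shows "continuous_on S f"
proof (cases k)
  case 0
  with assms show ?thesis
    by simp
next
  case (Suc m)
  with assms obtain f' where "\<forall>t\<in>S. (f has_vector_derivative f' t) (at t within S)"
    unfolding Suc Ck_vanishing.simps by blast
  then show ?thesis
    by (intro continuous_on_vector_derivative[of S f f']) auto
qed

lemma Ck_vanishing_Suc_imp: "Ck_vanishing S E (Suc k) f \<Longrightarrow> Ck_vanishing S E k f"
proof (induction k arbitrary: f)
  case 0
  then show ?case
    using Ck_vanishing_continuous_on[OF 0] Ck_vanishing_zero[OF 0] by simp
next
  case (Suc k)
  then obtain f' where f': "\<forall>t\<in>S. (f has_vector_derivative f' t) (at t within S)"
      "\<forall>t\<in>E. f t = 0" "Ck_vanishing S E (Suc k) f'"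
    by (auto simp only: Ck_vanishing.simps)
  from Suc.IH[OF f'(3)] f'(1,2) show ?case
    by auto
qed

section \<open>Closure under sums, products and composition\<close>

lemma Ck_vanishing_cong:
  assumes "Ck_vanishing S E k f" "E \<subseteq> S" "\<And>t. t \<in> S \<Longrightarrow> g t = f t"
  shows "Ck_vanishing S E k g"
proof (cases k)
  case 0
  with assms show ?thesis
    by (auto cong: continuous_on_cong simp: subset_iff)
next
  case (Suc m)
  with assms(1) obtain f' where f': "\<forall>t\<in>S. (f has_vector_derivative f' t) (at t within S)"
      "\<forall>t\<in>E. f t = 0" "Ck_vanishing S E m f'"
    by auto
  have "(g has_vector_derivative f' t) (at t within S)" if "t \<in> S" for t
    using f'(1) that assms(3) by (metis has_vector_derivative_transform)
  moreover have "\<forall>t\<in>E. g t = 0"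
    using f'(2) assms(2,3) by auto
  ultimately show ?thesis
    using f'(3) Suc by auto
qed

lemma Ck_vanishing_add:
  "Ck_vanishing S E k f \<Longrightarrow> Ck_vanishing S E k g \<Longrightarrow> Ck_vanishing S E k (\<lambda>t. f t + g t)"
proof (induction k arbitrary: f g)
  case 0
  then show ?case
    by (auto intro: continuous_on_add)
next
  case (Suc k)
  from Suc.prems obtain f' where f': "\<forall>t\<in>S. (f has_vector_derivative f' t) (at t within S)"
      "\<forall>t\<in>E. f t = 0" "Ck_vanishing S E k f'"
    by auto
  from Suc.prems obtain g' where g': "\<forall>t\<in>S. (g has_vector_derivative g' t) (at t within S)"
      "\<forall>t\<in>E. g t = 0" "Ck_vanishing S E k g'"
    by auto
  have "\<forall>t\<in>S. ((\<lambda>t. f t + g t) has_vector_derivative f' t + g' t) (at t within S)"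
    using f'(1) g'(1) by (intro ballI has_vector_derivative_add) auto
  moreover have "\<forall>t\<in>E. f t + g t = 0"
    using f'(2) g'(2) by simp
  ultimately show ?case
    unfolding Ck_vanishing.simps using Suc.IH[OF f'(3) g'(3)]
    by (intro exI[of _ "\<lambda>t. f' t + g' t"] conjI)
qed

lemma Ck_vanishing_linear:
  assumes "bounded_linear h"
  shows "Ck_vanishing S E k f \<Longrightarrow> Ck_vanishing S E k (\<lambda>t. h (f t))"
proof (induction k arbitrary: f)
  case 0
  then show ?case
    using assms by (auto intro: bounded_linear.continuous_on simp: linear_simps)
next
  case (Suc k)
  then obtain f' where f': "\<forall>t\<in>S. (f has_vector_derivative f' t) (at t within S)"
      "\<forall>t\<in>E. f t = 0" "Ck_vanishing S E k f'"
    by auto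
  have "\<forall>t\<in>S. ((\<lambda>t. h (f t)) has_vector_derivative h (f' t)) (at t within S)"
    using f'(1) by (intro ballI bounded_linear.has_vector_derivative[OF assms]) auto
  moreover have "\<forall>t\<in>E. h (f t) = 0"
    using f'(2) assms by (simp add: linear_simps)
  ultimately show ?case
    unfolding Ck_vanishing.simps using Suc.IH[OF f'(3)]
    by (intro exI[of _ "\<lambda>t. h (f' t)"] conjI)
qed

text \<open>Leibniz rule: every term of an iterated derivative of the product contains
  \<open>f\<close> or one of its derivatives, so flatness of the first factor on \<open>E\<close>
  suffices. The induction meets undifferentiated factors one order lower, hence
  \<open>Ck_vanishing_Suc_imp\<close>.\<close>

lemma Ck_vanishing_bilinear:
  assumes "bounded_bilinear h"
  shows "Ck_vanishing S E k f \<Longrightarrow> Ck_vanishing S {} k g \<Longrightarrow> Ck_vanishing S E k (\<lambda>t. h (f t) (g t))"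
proof (induction k arbitrary: f g)
  case 0
  then show ?case
    using assms by (auto intro: bounded_bilinear.continuous_on simp: bounded_bilinear.zero_left)
next
  case (Suc k)
  from Suc.prems(1) obtain f' where f': "\<forall>t\<in>S. (f has_vector_derivative f' t) (at t within S)"
      "\<forall>t\<in>E. f t = 0" "Ck_vanishing S E k f'"
    by auto
  from Suc.prems(2) obtain g' where g': "\<forall>t\<in>S. (g has_vector_derivative g' t) (at t within S)"
      "Ck_vanishing S {} k g'"
    by auto
  have "Ck_vanishing S E k (\<lambda>t. h (f t) (g' t) + h (f' t) (g t))"
    by (rule Ck_vanishing_add[OF Suc.IH[OF Ck_vanishing_Suc_imp[OF Suc.prems(1)] g'(2)]
        Suc.IH[OF f'(3) Ck_vanishing_Suc_imp[OF Suc.prems(2)]]])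
  moreover have "\<forall>t\<in>S. ((\<lambda>t. h (f t) (g t)) has_vector_derivative
      h (f t) (g' t) + h (f' t) (g t)) (at t within S)"
    using f'(1) g'(1)
    by (intro ballI bounded_bilinear.has_vector_derivative[OF assms]) auto
  moreover have "\<forall>t\<in>E. h (f t) (g t) = 0"
    using f'(2) assms by (simp add: bounded_bilinear.zero_left)
  ultimately show ?case
    unfolding Ck_vanishing.simps by (intro exI[of _ "\<lambda>t. h (f t) (g' t) + h (f' t) (g t)"] conjI)
qed

text \<open>By the chain rule the derivative is \<open>\<phi>'\<close> times \<open>f'\<close>
  composed with \<open>\<phi>\<close>. The second factor is flat on \<open>E'\<close> by induction
  and makes the product flat there, so flatness survives reparametrization.\<close>

lemma Ck_vanishing_compose:
  "Ck_vanishing S E k f \<Longrightarrow> Ck_vanishing S' {} k \<phi> \<Longrightarrow> \<phi> ` S' \<subseteq> S \<Longrightarrow> \<phi> ` E' \<subseteq> E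
     \<Longrightarrow> Ck_vanishing S' E' k (\<lambda>t. f (\<phi> t))"
proof (induction k arbitrary: f)
  case 0
  then show ?case
    by (auto intro: continuous_on_compose2)
next
  case (Suc k)
  from Suc.prems(1) obtain f' where f': "\<forall>t\<in>S. (f has_vector_derivative f' t) (at t within S)"
      "\<forall>t\<in>E. f t = 0" "Ck_vanishing S E k f'"
    by auto
  from Suc.prems(2) obtain \<phi>' where \<phi>': "\<forall>t\<in>S'. (\<phi> has_vector_derivative \<phi>' t) (at t within S')"
      "Ck_vanishing S' {} k \<phi>'"
    by auto
  have "Ck_vanishing S' E' k (\<lambda>t. f' (\<phi> t))"
    using Suc.IH[OF f'(3) Ck_vanishing_Suc_imp[OF Suc.prems(2)] Suc.prems(3,4)] .
  \<comment> \<open>The scalar product is flipped because the product lemma expects the flat factor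
    first.\<close>
  then have "Ck_vanishing S' E' k (\<lambda>t. \<phi>' t *\<^sub>R f' (\<phi> t))"
    using Ck_vanishing_bilinear[OF bounded_bilinear.flip[OF bounded_bilinear_scaleR]] \<phi>'(2)
    by blast
  moreover have "((\<lambda>t. f (\<phi> t)) has_vector_derivative \<phi>' t *\<^sub>R f' (\<phi> t)) (at t within S')"
    if "t \<in> S'" for t
  proof -
    have "(f has_vector_derivative f' (\<phi> t)) (at (\<phi> t) within \<phi> ` S')"
      using f'(1) Suc.prems(3) that by (blast intro: has_vector_derivative_within_subset)
    with \<phi>'(1) that show ?thesis
      using vector_diff_chain_within[of \<phi> "\<phi>' t" t S' f] by (simp add: o_def)
  qed
  moreover have "\<forall>t\<in>E'. f (\<phi> t) = 0"
    using f'(2) Suc.prems(4) by blast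
  ultimately show ?case
    unfolding Ck_vanishing.simps
    by (intro exI[of _ "\<lambda>t. \<phi>' t *\<^sub>R f' (\<phi> t)"] conjI ballI)
      (auto simp del: Ck_vanishing.simps)
qed

text \<open>The derivative is a polynomial in \<open>inverse\<close> itself, so each order follows
  from the one below by the product rule.\<close>

lemma Ck_vanishing_inverse: "Ck_vanishing {0<..} {} k (inverse :: real \<Rightarrow> real)"
proof (induction k)
  case 0
  then show ?case
    by (auto intro!: continuous_intros)
next
  case (Suc k)
  have "Ck_vanishing {0<..} {} k (\<lambda>t::real. - (inverse t * inverse t))"
    by (intro Ck_vanishing_linear[OF bounded_linear_minus[OF bounded_linear_ident]]
        Ck_vanishing_bilinear[OF bounded_bilinear_mult] Suc)
  moreover have "(inverse has_vector_derivative - (inverse t * inverse t)) (at t within {0<..})"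
    if "0 < t" for t :: real
    using that
    by (auto intro!: derivative_eq_intros simp flip: has_real_derivative_iff_has_vector_derivative)
  ultimately show ?case
    by (auto intro!: exI[of _ "\<lambda>t. - (inverse t * inverse t)"])
qed

text \<open>The derivative is half of \<open>inverse\<close> composed with \<open>sqrt\<close>,
  which is again C^k by the induction hypothesis.\<close>

lemma Ck_vanishing_sqrt: "Ck_vanishing {0<..} {} k sqrt"
proof (induction k)
  case 0
  then show ?case
    by (auto intro!: continuous_intros)
next
  case (Suc k)
  have "Ck_vanishing {0<..} {} k (\<lambda>t. inverse (sqrt t))"
    by (rule Ck_vanishing_compose[OF Ck_vanishing_inverse Suc]) auto
  then have "Ck_vanishing {0<..} {} k (\<lambda>t. inverse (sqrt t) / 2)"
    using Ck_vanishing_linear[OF bounded_linear_divide] by blast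
  moreover have "(sqrt has_vector_derivative inverse (sqrt t) / 2) (at t within {0<..})"
    if "0 < t" for t
    using that
    by (auto intro!: derivative_eq_intros simp flip: has_real_derivative_iff_has_vector_derivative)
  ultimately show ?case
    by (auto intro!: exI[of _ "\<lambda>t. inverse (sqrt t) / 2"])
qed

text \<open>On a nondegenerate closed interval derivatives are unique, even at the end points, so
  the derivative hidden in the definition agrees with any given \<open>g\<close>.\<close>

lemma Ck_vanishing_deriv:
  fixes f :: "real \<Rightarrow> 'a::euclidean_space"
  assumes "0 < L" "E \<subseteq> {0..L}" "Ck_vanishing {0..L} E (Suc k) f"
    and g: "\<And>t. t \<in> {0..L} \<Longrightarrow> (f has_vector_derivative g t) (at t within {0..L})"
  shows "Ck_vanishing {0..L} E k g"
proof -
  from assms(3) obtain f' where f': "\<forall>t\<in>{0..L}. (f has_vector_derivative f' t) (at t within {0..L})"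
      "Ck_vanishing {0..L} E k f'"
    by auto
  have "g t = f' t" if "t \<in> {0..L}" for t
    using vector_derivative_within_closed_interval[OF \<open>0 < L\<close> that] g[OF that] f'(1) that by metis
  then show ?thesis
    using Ck_vanishing_cong[OF f'(2) assms(2)] by blast
qed

lemma nth_deriv_on_1_eqI:
  assumes "0 < L" "t \<in> {0..L}" "(f has_vector_derivative d) (at t within {0..L})"
  shows "nth_deriv_on L 1 f t = d"
  using vector_derivative_within_closed_interval[OF assms] by simp

lemma nth_deriv_on_1_works:
  assumes "0 < L" "Ck_vanishing {0..L} E (Suc k) f" "t \<in> {0..L}"
  shows "(f has_vector_derivative nth_deriv_on L 1 f t) (at t within {0..L})"
proof -
  from assms(2,3) obtain d where "(f has_vector_derivative d) (at t within {0..L})"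
    unfolding Ck_vanishing.simps by blast
  with nth_deriv_on_1_eqI[OF assms(1,3) this] show ?thesis
    by simp
qed

section \<open>Reparametrization by arc length\<close>

text \<open>In the application \<open>v\<close> is the speed of a curve, \<open>s\<close> its arc
  length from the start, and \<open>\<sigma>\<close> the change of parameter from arc length back to
  the old one.\<close>

context
  fixes L :: real and v s \<sigma> :: "real \<Rightarrow> real"
  assumes L: "0 < L"
    and cont: "continuous_on {0..L} v"
    and pos: "\<And>t. t \<in> {0..L} \<Longrightarrow> 0 < v t"
    and s_def: "s = (\<lambda>t. integral {0..t} v)"
    and \<sigma>_def: "\<sigma> = the_inv_into {0..L} s"
begin

lemma integral_upto_deriv:
  "t \<in> {0..L} \<Longrightarrow> (s has_vector_derivative v t) (at t within {0..L})"
  unfolding s_def by (rule integral_has_vector_derivative[OF cont])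

lemma integral_upto_0: "s 0 = 0"
  by (simp add: s_def)

lemma integral_upto_continuous_on: "continuous_on {0..L} s"
  using integral_upto_deriv by (rule continuous_on_vector_derivative)

lemma integral_upto_strict_mono: "strict_mono_on {0..L} s"
proof (rule strict_mono_onI)
  fix a b assume ab: "a \<in> {0..L}" "b \<in> {0..L}" "a < b"
  show "s a < s b"
  proof (rule DERIV_pos_imp_increasing_open[OF \<open>a < b\<close>])
    show "continuous_on {a..b} s"
      using integral_upto_continuous_on by (rule continuous_on_subset) (use ab in auto)
    fix t assume t: "a < t" "t < b"
    then have "(s has_vector_derivative v t) (at t)"
      using integral_upto_deriv[of t] ab at_within_Icc_at[of 0 t L] by auto
    with pos[of t] t ab show "\<exists>d. (s has_real_derivative d) (at t) \<and> 0 < d"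
      by (auto simp: has_real_derivative_iff_has_vector_derivative)
  qed
qed

lemma integral_upto_image: "s ` {0..L} = {0..s L}"
proof
  show "s ` {0..L} \<subseteq> {0..s L}"
    using strict_mono_on_less_eq[OF integral_upto_strict_mono] integral_upto_0 L
    by (metis atLeastAtMost_iff image_subsetI less_eq_real_def)
  show "{0..s L} \<subseteq> s ` {0..L}"
    using IVT'[of s 0 _ L] integral_upto_continuous_on integral_upto_0 L by fastforce
qed

lemma inverse_integral_left: "t \<in> {0..L} \<Longrightarrow> \<sigma> (s t) = t"
  unfolding \<sigma>_def
  using integral_upto_strict_mono by (intro the_inv_into_f_f strict_mono_on_imp_inj_on)

lemma inverse_integral_image: "\<sigma> ` {0..s L} = {0..L}"
  using inverse_integral_left by (force simp flip: integral_upto_image)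

text \<open>Inverse function rule relative to the interval, which covers the end points as well. It
  needs continuity of \<open>\<sigma>\<close>, which holds because \<open>s\<close> is a continuous
  injection of a compact interval.\<close>

lemma inverse_integral_deriv:
  assumes "u \<in> {0..s L}"
  shows "(\<sigma> has_vector_derivative inverse (v (\<sigma> u))) (at u within {0..s L})"
proof -
  obtain t where t: "t \<in> {0..L}" "u = s t"
    using assms integral_upto_image by blast
  have cont': "continuous_on (s ` {0..L}) \<sigma>"
    using integral_upto_continuous_on inverse_integral_left by (intro continuous_on_inv) auto
  have "(\<sigma> has_derivative (\<lambda>h. inverse (v t) * h)) (at (s t) within s ` {0..L})"
  proof (rule has_derivative_inverse_within)
    show "(s has_derivative (\<lambda>h. h * v t)) (at t within {0..L})"
      using integral_upto_deriv[OF t(1)] by (simp add: has_vector_derivative_def)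
    show "continuous (at (s t) within s ` {0..L}) \<sigma>"
      using cont' t(1) by (auto simp: continuous_on_eq_continuous_within)
    show "(\<lambda>h. inverse (v t) * h) \<circ> (\<lambda>h. h * v t) = id"
      using pos[OF t(1)] by (auto simp: fun_eq_iff)
    show "linear (\<lambda>h. inverse (v t) * h)"
      using bounded_linear.linear bounded_linear_mult_right by blast
  qed (use t inverse_integral_left in auto)
  with t show ?thesis
    by (simp add: has_vector_derivative_def integral_upto_image inverse_integral_left mult.commute)
qed

text \<open>Bootstrapping: the derivative of \<open>\<sigma>\<close> is the reciprocal of
  \<open>v\<close> composed with \<open>\<sigma>\<close>, so C^k regularity of
  \<open>\<sigma>\<close> yields one order more.\<close>

lemma inverse_integral_Ck:
  assumes "\<And>k. Ck_vanishing {0..L} {} k v"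
  shows "Ck_vanishing {0..s L} {} k \<sigma>"
proof (induction k)
  case 0
  show ?case
    using continuous_on_vector_derivative[OF inverse_integral_deriv] by simp
next
  case (Suc k)
  have "Ck_vanishing {0..s L} {} k (\<lambda>u. v (\<sigma> u))"
    by (rule Ck_vanishing_compose[OF assms Suc]) (use inverse_integral_image in auto)
  then have "Ck_vanishing {0..s L} {} k (\<lambda>u. inverse (v (\<sigma> u)))"
    by (rule Ck_vanishing_compose[OF Ck_vanishing_inverse])
      (use pos inverse_integral_image in \<open>blast intro: greaterThan_iff[THEN iffD2]\<close>)+
  with inverse_integral_deriv show ?case
    unfolding Ck_vanishing.simps
    by (intro exI[of _ "\<lambda>u. inverse (v (\<sigma> u))"] conjI ballI) auto
qed

end

section \<open>Counting zeros\<close>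

lemma Rolle_exp:
  fixes f f' :: "real \<Rightarrow> real"
  assumes "a < b" "f a = 0" "f b = 0" "continuous_on {a..b} f"
    and deriv: "\<And>t. a < t \<Longrightarrow> t < b \<Longrightarrow> (f has_real_derivative f' t) (at t)"
  shows "\<exists>z. a < z \<and> z < b \<and> f z + f' z = 0"
proof -
  have "\<exists>z. a < z \<and> z < b \<and> (*) (exp z * (f z + f' z)) = (\<lambda>v. 0)"
  proof (rule Rolle_deriv[OF \<open>a < b\<close>])
    show "exp a * f a = exp b * f b"
      using assms by simp
    show "continuous_on {a..b} (\<lambda>t. exp t * f t)"
      using assms by (intro continuous_intros)
    show "((\<lambda>t. exp t * f t) has_derivative (*) (exp t * (f t + f' t))) (at t)"
      if "a < t" "t < b" for t
      using deriv[OF that]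
      by (auto intro!: derivative_eq_intros simp: algebra_simps
          simp flip: has_field_derivative_def)
  qed
  \<comment> \<open>The derivative is the linear map of multiplication by
    \<open>exp z * (f z + f' z)\<close>. It is the zero map, so evaluation at 1 kills the
    multiplier, and \<open>exp z\<close> is nonzero.\<close>
  then show ?thesis
    by (metis exp_not_eq_zero mult.right_neutral mult_eq_0_iff)
qed

text \<open>Counting the points of \<open>Q\<close> below \<open>a\<close> is a strictly increasing
  function of \<open>a\<close> on \<open>A\<close>, with values among the \<open>card Q + 1\<close>
  numbers from 0 to \<open>card Q\<close>. Injectivity gives the finiteness of \<open>A\<close>
  too.\<close>

lemma card_interlacing:
  fixes A Q :: "'a::linorder set"
  assumes "finite Q" and sep: "\<And>a b. a \<in> A \<Longrightarrow> b \<in> A \<Longrightarrow> a < b \<Longrightarrow> \<exists>z\<in>Q. a < z \<and> z < b"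
  shows "finite A \<and> card A \<le> Suc (card Q)"
proof -
  define g where "g a = card {z \<in> Q. z < a}" for a
  have "g a < g b" if ab: "a \<in> A" "b \<in> A" "a < b" for a b
  proof -
    from sep[OF ab] obtain z where "z \<in> Q" "a < z" "z < b"
      by blast
    then have "z \<in> {z \<in> Q. z < b} - {z \<in> Q. z < a}"
      by simp
    moreover have "{z \<in> Q. z < a} \<subseteq> {z \<in> Q. z < b}"
      using ab(3) by (blast intro: less_trans)
    ultimately have "{z \<in> Q. z < a} \<subset> {z \<in> Q. z < b}"
      by blast
    with \<open>finite Q\<close> show ?thesis
      unfolding g_def by (simp add: psubset_card_mono)
  qed
  then have inj: "inj_on g A"
    by (intro strict_mono_on_imp_inj_on strict_mono_onI)
  have sub: "g ` A \<subseteq> {..card Q}"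
    unfolding g_def using \<open>finite Q\<close> by (auto intro: card_mono)
  show ?thesis
    using inj_on_finite[OF inj sub] card_inj_on_le[OF inj sub] by simp
qed

section \<open>One application of T\<close>

text \<open>The invariant of the iteration. Contact of every order with the x-axis is recorded as
  vanishing of the second coordinate and all its derivatives at both ends.\<close>

definition flat_curve :: "plane_curve \<Rightarrow> bool" where
  "flat_curve \<gamma> \<longleftrightarrow> 0 < len \<gamma> \<and>
     (\<forall>k. Ck_vanishing {0..len \<gamma>} {} k (param \<gamma>)) \<and>
     (\<forall>k. Ck_vanishing {0..len \<gamma>} {0, len \<gamma>} k (\<lambda>t. param \<gamma> t $ 2)) \<and>
     (\<forall>t\<in>{0..len \<gamma>}. norm (nth_deriv_on (len \<gamma>) 1 (param \<gamma>) t) = 1)"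

lemma flat_curveI:
  assumes "smooth_curve \<gamma>" "flat_unit_ends \<gamma>"
  shows "flat_curve \<gamma>"
proof -
  define L c where "L = len \<gamma>" and "c = param \<gamma>"
  have L: "0 < L" and
    unit: "\<And>t. t \<in> {0..L} \<Longrightarrow> norm (nth_deriv_on L 1 c t) = 1" and
    diff: "\<And>k t. t \<in> {0..L} \<Longrightarrow> nth_deriv_on L k c differentiable (at t within {0..L})"
    using assms(1) by (auto simp: smooth_curve_def smooth_on_interval_def L_def c_def)
  have deriv: "(nth_deriv_on L k c has_vector_derivative nth_deriv_on L (Suc k) c t)
      (at t within {0..L})" if "t \<in> {0..L}" for k t
    using diff[OF that] by (simp add: vector_derivative_works)
  have cont: "continuous_on {0..L} (nth_deriv_on L k c)" for k
    using deriv by (rule continuous_on_vector_derivative)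
  have zero: "nth_deriv_on L k c t $ 2 = 0" if "t \<in> {0, L}" for k t
  proof -
    \<comment> \<open>Order 0 uses that the ends lie on the axis, order 1 that the tangent there is
      horizontal, higher orders that the derivatives vanish.\<close>
    consider "k = 0" | "k = 1" | "k \<ge> 2"
      by linarith
    then show ?thesis
      using that assms(2) by cases (auto simp: flat_unit_ends_def L_def c_def)
  qed
  \<comment> \<open>Generalized over the starting order \<open>j\<close>, since the induction passes
    to the next derivative; \<open>j = 0\<close> is the curve itself.\<close>
  have "Ck_vanishing {0..L} {} k (nth_deriv_on L j c)" for k j
  proof (induction k arbitrary: j)
    case (Suc k)
    then show ?case
      unfolding Ck_vanishing.simps using deriv
      by (intro exI[of _ "nth_deriv_on L (Suc j) c"] conjI ballI)
        (simp_all del: nth_deriv_on.simps)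
  qed (use cont in auto)
  moreover have "Ck_vanishing {0..L} {0, L} k (\<lambda>t. nth_deriv_on L j c t $ 2)" for k j
  proof (induction k arbitrary: j)
    case 0
    then show ?case
      using cont zero by (auto intro!: continuous_intros)
  next
    case (Suc k)
    have "((\<lambda>t. nth_deriv_on L j c t $ 2) has_vector_derivative nth_deriv_on L (Suc j) c t $ 2)
        (at t within {0..L})" if "t \<in> {0..L}" for t
      using deriv[OF that] by (rule bounded_linear.has_vector_derivative[OF bounded_linear_vec_nth])
    with Suc show ?case
      unfolding Ck_vanishing.simps using zero
      by (intro exI[of _ "\<lambda>t. nth_deriv_on L (Suc j) c t $ 2"] conjI ballI)
  qed
  ultimately show ?thesis
    using L unit unfolding flat_curve_def L_def c_def by (metis nth_deriv_on.simps(1))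
qed

text \<open>Here \<open>c\<close> is the rear track, \<open>c1\<close> its unit tangent,
  \<open>w\<close> the front track in the rear parameter, \<open>v\<close> its speed,
  \<open>s\<close> its arc length and \<open>\<sigma>\<close> the inverse of
  \<open>s\<close>.\<close>

context
  fixes \<gamma> :: plane_curve and L :: real and c c1 w v s \<sigma>
  assumes flat: "flat_curve \<gamma>"
    and L_def: "L = len \<gamma>"
    and c_def: "c = param \<gamma>"
    and c1_def: "c1 = nth_deriv_on L 1 c"
    and w_def: "w = (\<lambda>t. c t + c1 t)"
    and v_def: "v = (\<lambda>t. norm (nth_deriv_on L 1 w t))"
    and s_def: "s = (\<lambda>t. integral {0..t} v)"
    and \<sigma>_def: "\<sigma> = the_inv_into {0..L} s"
begin

section \<open>Smoothness, flatness and speed of the front track\<close>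

lemma len_pos: "0 < L"
  using flat by (simp add: flat_curve_def L_def)

lemma param_Ck: "Ck_vanishing {0..L} {} k c"
  using flat by (simp add: flat_curve_def L_def c_def)

lemma param_deriv: "t \<in> {0..L} \<Longrightarrow> (c has_vector_derivative c1 t) (at t within {0..L})"
  unfolding c1_def using nth_deriv_on_1_works[OF len_pos param_Ck] .

lemma param_deriv_Ck: "Ck_vanishing {0..L} {} k c1"
  using Ck_vanishing_deriv[OF len_pos _ param_Ck] param_deriv by auto

lemma param_deriv2:
  "t \<in> {0..L} \<Longrightarrow> (c1 has_vector_derivative nth_deriv_on L 1 c1 t) (at t within {0..L})"
  using nth_deriv_on_1_works[OF len_pos param_deriv_Ck] .

lemma norm_param_deriv: "t \<in> {0..L} \<Longrightarrow> norm (c1 t) = 1"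
  using flat by (simp add: flat_curve_def L_def c_def c1_def)

lemma front_Ck: "Ck_vanishing {0..L} {} k w"
  unfolding w_def by (intro Ck_vanishing_add param_Ck param_deriv_Ck)

lemma front_flat: "Ck_vanishing {0..L} {0, L} k (\<lambda>t. w t $ 2)"
proof -
  have c: "Ck_vanishing {0..L} {0, L} k (\<lambda>t. c t $ 2)" for k
    using flat by (simp add: flat_curve_def L_def c_def)
  have "Ck_vanishing {0..L} {0, L} k (\<lambda>t. c1 t $ 2)"
    by (rule Ck_vanishing_deriv[OF len_pos _ c])
      (use param_deriv len_pos in
        \<open>auto intro: bounded_linear.has_vector_derivative[OF bounded_linear_vec_nth]\<close>)
  with c show ?thesis
    unfolding w_def by (auto intro: Ck_vanishing_add)
qed

text \<open>The velocity of \<open>w\<close> is \<open>c1 + c2\<close> with \<open>c2\<close>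
  orthogonal to the unit vector \<open>c1\<close>, so its inner product with \<open>c1\<close> is 1;
  Cauchy-Schwarz bounds that by the speed.\<close>

lemma front_speed_ge_1:
  assumes t: "t \<in> {0..L}"
  shows "1 \<le> v t"
proof -
  define c2 where "c2 = nth_deriv_on L 1 c1"
  have c2: "(c1 has_vector_derivative c2 t) (at t within {0..L})"
    unfolding c2_def by (rule param_deriv2[OF t])
  have "((\<lambda>t. c1 t \<bullet> c1 t) has_vector_derivative c1 t \<bullet> c2 t + c2 t \<bullet> c1 t) (at t within {0..L})"
    by (rule bounded_bilinear.has_vector_derivative[OF bounded_bilinear_inner c2 c2])
  \<comment> \<open>The squared norm is constantly 1; comparing its two derivatives gives the
    orthogonality.\<close>
  moreover have "((\<lambda>t. c1 t \<bullet> c1 t) has_vector_derivative 0) (at t within {0..L})"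
    by (rule has_vector_derivative_transform[OF t _ has_vector_derivative_const[of 1]])
      (simp add: norm_param_deriv dot_square_norm)
  ultimately have "c1 t \<bullet> c2 t + c2 t \<bullet> c1 t = 0"
    using vector_derivative_within_closed_interval[OF len_pos t] by metis
  then have orth: "c2 t \<bullet> c1 t = 0"
    by (simp add: inner_commute)
  have "nth_deriv_on L 1 w t = c1 t + c2 t"
    unfolding w_def
    by (intro nth_deriv_on_1_eqI[OF len_pos t] has_vector_derivative_add param_deriv[OF t] c2)
  then have "v t = norm (c1 t + c2 t)"
    by (simp add: v_def)
  moreover have "(c1 t + c2 t) \<bullet> c1 t \<le> norm (c1 t + c2 t) * norm (c1 t)"
    by (rule norm_cauchy_schwarz)
  ultimately show ?thesis
    using orth norm_param_deriv[OF t] by (simp add: inner_add_left dot_square_norm)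
qed

lemma front_deriv:
  "t \<in> {0..L} \<Longrightarrow> (w has_vector_derivative nth_deriv_on L 1 w t) (at t within {0..L})"
  using nth_deriv_on_1_works[OF len_pos front_Ck] .

text \<open>The norm is smooth away from zero: it is \<open>sqrt\<close> of an inner product, which
  the lower bound on the speed keeps inside the open half-line.\<close>

lemma front_speed_Ck: "Ck_vanishing {0..L} {} k v"
proof -
  have "Ck_vanishing {0..L} {} k (nth_deriv_on L 1 w)"
    using Ck_vanishing_deriv[OF len_pos _ front_Ck] front_deriv by auto
  then have "Ck_vanishing {0..L} {} k (\<lambda>t. nth_deriv_on L 1 w t \<bullet> nth_deriv_on L 1 w t)"
    by (intro Ck_vanishing_bilinear[OF bounded_bilinear_inner])
  then have "Ck_vanishing {0..L} {} k (\<lambda>t. sqrt (nth_deriv_on L 1 w t \<bullet> nth_deriv_on L 1 w t))"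
  proof (rule Ck_vanishing_compose[OF Ck_vanishing_sqrt])
    show "(\<lambda>t. nth_deriv_on L 1 w t \<bullet> nth_deriv_on L 1 w t) ` {0..L} \<subseteq> {0<..}"
      using front_speed_ge_1 unfolding v_def by (force simp del: nth_deriv_on.simps)
  qed auto
  then show ?thesis
    unfolding v_def norm_eq_sqrt_inner .
qed

lemma front_speed_pos: "t \<in> {0..L} \<Longrightarrow> 0 < v t"
  using front_speed_ge_1 by fastforce

text \<open>The five assumptions of the arc length context, in its order, for instantiating its
  results.\<close>

lemmas reparam = len_pos Ck_vanishing_continuous_on[OF front_speed_Ck[of 0]] front_speed_pos
  s_def \<sigma>_def

lemma T_eq: "T \<gamma> = Curve (s L) (restrict (\<lambda>u. w (\<sigma> u)) {0..s L})"
  unfolding T_def arc_length_reparam_def \<sigma>_def s_def v_def w_def c1_def c_def L_def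
  by (simp add: arc_length_def[abs_def])

lemma front_len_pos: "0 < s L"
  using strict_mono_onD[OF integral_upto_strict_mono[OF reparam], of 0 L] len_pos
    integral_upto_0[OF reparam] by simp

lemma flat_curve_T: "flat_curve (T \<gamma>)"
proof -
  let ?p = "\<lambda>u. w (\<sigma> u)" and ?I = "{0..s L}"
  have \<sigma>_Ck: "Ck_vanishing ?I {} k \<sigma>" for k
    by (rule inverse_integral_Ck[OF reparam front_speed_Ck])
  have im: "\<sigma> ` ?I = {0..L}"
    by (rule inverse_integral_image[OF reparam])
  have ends: "\<sigma> ` {0, s L} \<subseteq> {0, L}"
    using inverse_integral_left[OF reparam, of 0] inverse_integral_left[OF reparam, of L]
      integral_upto_0[OF reparam] len_pos by auto
  have smooth: "Ck_vanishing ?I {} k ?p" for k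
    by (rule Ck_vanishing_compose[OF front_Ck \<sigma>_Ck]) (use im in auto)
  have flat2: "Ck_vanishing ?I {0, s L} k (\<lambda>u. ?p u $ 2)" for k
    by (rule Ck_vanishing_compose[OF front_flat \<sigma>_Ck]) (use im ends in auto)
  have unit: "norm (nth_deriv_on (s L) 1 (restrict ?p ?I) u) = 1" if u: "u \<in> ?I" for u
  proof -
    have \<sigma>u: "\<sigma> u \<in> {0..L}"
      using im u by blast
    have "(w has_vector_derivative nth_deriv_on L 1 w (\<sigma> u)) (at (\<sigma> u) within \<sigma> ` ?I)"
      using front_deriv[OF \<sigma>u] im by simp
    \<comment> \<open>The chain rule divides the velocity of \<open>w\<close> by its own norm
      \<open>v\<close>, which yields unit speed.\<close>
    then have "(?p has_vector_derivative inverse (v (\<sigma> u)) *\<^sub>R nth_deriv_on L 1 w (\<sigma> u))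
        (at u within ?I)"
      using vector_diff_chain_within[OF inverse_integral_deriv[OF reparam u]] by (simp add: o_def)
    then have "(restrict ?p ?I has_vector_derivative
        inverse (v (\<sigma> u)) *\<^sub>R nth_deriv_on L 1 w (\<sigma> u)) (at u within ?I)"
      by (rule has_vector_derivative_transform[OF u, rotated]) auto
    from nth_deriv_on_1_eqI[OF front_len_pos u this] front_speed_pos[OF \<sigma>u] show ?thesis
      by (simp add: v_def del: nth_deriv_on.simps)
  qed
  show ?thesis
    unfolding flat_curve_def T_eq plane_curve.sel
    using front_len_pos unit
    by (auto intro: Ck_vanishing_cong[OF smooth] Ck_vanishing_cong[OF flat2]
        simp del: nth_deriv_on.simps)
qed

section \<open>Comparing the axis crossings of rear and front tracks\<close>

lemma zeros_T: "s ` {t \<in> {0<..<L}. w t $ 2 = 0} \<subseteq> axis_params (T \<gamma>)"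
proof
  fix u assume "u \<in> s ` {t \<in> {0<..<L}. w t $ 2 = 0}"
  then obtain t where t: "t \<in> {0<..<L}" "w t $ 2 = 0" "u = s t"
    by blast
  then have "0 < s t" "s t < s L"
    using strict_mono_onD[OF integral_upto_strict_mono[OF reparam], of 0 t]
      strict_mono_onD[OF integral_upto_strict_mono[OF reparam], of t L]
      integral_upto_0[OF reparam] by auto
  with t show "u \<in> axis_params (T \<gamma>)"
    using inverse_integral_left[OF reparam, of t] by (simp add: axis_params_def T_eq)
qed

text \<open>With k interior zeros the second coordinate has k + 2 zeros, counting the ends. Rolle
  separates any two of them by a zero of \<open>w t $ 2\<close>, so there are at least k + 1 of
  these, and \<open>s\<close> carries them injectively to crossings of
  \<open>T \<gamma>\<close>.\<close>

lemma card_axis_params_T: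
  assumes fin: "finite (axis_params (T \<gamma>))"
  shows "finite (axis_params \<gamma>) \<and> Suc (card (axis_params \<gamma>)) \<le> card (axis_params (T \<gamma>))"
proof -
  define Q where "Q = {t \<in> {0<..<L}. w t $ 2 = 0}"
  define A where "A = insert 0 (insert L (axis_params \<gamma>))"
  have A_zero: "a \<in> {0..L} \<and> c a $ 2 = 0" if "a \<in> A" for a
  proof -
    have "Ck_vanishing {0..L} {0, L} 0 (\<lambda>t. c t $ 2)"
      using flat by (simp only: flat_curve_def L_def c_def)
    then show ?thesis
      using that len_pos by (auto simp: A_def axis_params_def L_def c_def)
  qed
  have inj: "inj_on s Q"
    by (rule inj_on_subset[OF strict_mono_on_imp_inj_on[OF integral_upto_strict_mono[OF reparam]]])
      (auto simp: Q_def)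
  have finQ: "finite Q" and cardQ: "card Q \<le> card (axis_params (T \<gamma>))"
    using inj_on_finite[OF inj _ fin] card_inj_on_le[OF inj _ fin] zeros_T by (simp_all add: Q_def)
  have "finite A \<and> card A \<le> Suc (card Q)"
  proof (rule card_interlacing[OF finQ])
    fix a b assume ab: "a \<in> A" "b \<in> A" "a < b"
    then have ab': "0 \<le> a" "b \<le> L"
      using A_zero[of a] A_zero[of b] by auto
    have "\<exists>z. a < z \<and> z < b \<and> c z $ 2 + c1 z $ 2 = 0"
    proof (rule Rolle_exp[OF \<open>a < b\<close>])
      show "continuous_on {a..b} (\<lambda>t. c t $ 2)"
        using continuous_on_subset[OF Ck_vanishing_continuous_on[OF param_Ck]] ab'
        by (intro continuous_intros) auto
      show "((\<lambda>t. c t $ 2) has_real_derivative c1 t $ 2) (at t)" if "a < t" "t < b" for t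
      proof -
        have "(c has_vector_derivative c1 t) (at t)"
          using param_deriv[of t] at_within_Icc_at[of 0 t L] that ab' by auto
        then show ?thesis
          unfolding has_real_derivative_iff_has_vector_derivative
          by (rule bounded_linear.has_vector_derivative[OF bounded_linear_vec_nth])
      qed
    qed (use A_zero ab in auto)
    then obtain z where "a < z" "z < b" "c z $ 2 + c1 z $ 2 = 0"
      by blast
    with ab' show "\<exists>z\<in>Q. a < z \<and> z < b"
      by (intro bexI[of _ z]) (auto simp: Q_def w_def)
  qed
  \<comment> \<open>The ends are distinct and lie outside the open parameter interval, hence exactly
    two extra points.\<close>
  moreover have "card A = Suc (Suc (card (axis_params \<gamma>)))" if "finite (axis_params \<gamma>)"
    unfolding A_def using that len_pos by (auto simp: axis_params_def L_def)
  ultimately show ?thesis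
    using cardQ by (auto simp: A_def)
qed

end

section \<open>Iterating the gain of one crossing\<close>

theorem corollary5p3:
  fixes \<Gamma> :: plane_curve and n :: nat
  assumes "smooth_curve \<Gamma>" and "flat_unit_ends \<Gamma>"
    and "Z \<Gamma> = enat n"
  shows "\<not> (\<exists>\<gamma>. smooth_curve \<gamma> \<and> flat_unit_ends \<gamma> \<and> (T ^^ (n + 1)) \<gamma> = \<Gamma>)"
proof
  assume "\<exists>\<gamma>. smooth_curve \<gamma> \<and> flat_unit_ends \<gamma> \<and> (T ^^ (n + 1)) \<gamma> = \<Gamma>"
  then obtain \<gamma> where \<gamma>: "flat_curve \<gamma>" "(T ^^ (n + 1)) \<gamma> = \<Gamma>"
    using flat_curveI by blast
  have flat: "flat_curve ((T ^^ m) \<gamma>)" for m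
    by (induction m) (use \<gamma>(1) flat_curve_T in auto)
  \<comment> \<open>Finiteness is a premise because \<open>card\<close> of an infinite set is 0. It
    passes from the image under \<open>T\<close> down to the curve, so the induction hypothesis
    applies.\<close>
  have count: "finite (axis_params ((T ^^ m) \<gamma>)) \<Longrightarrow> m \<le> card (axis_params ((T ^^ m) \<gamma>))" for m
  proof (induction m)
    case (Suc m)
    \<comment> \<open>The seven \<open>refl\<close> discharge the defining equations of the context,
      from \<open>L\<close> to \<open>\<sigma>\<close>.\<close>
    with card_axis_params_T[OF flat refl refl refl refl refl refl refl, of m] show ?case
      by auto
  qed simp
  from assms(3) have "finite (axis_params \<Gamma>)" "card (axis_params \<Gamma>) = n"
    by (auto simp: Z_def split: if_splits)
  with count[of "n + 1"] \<gamma>(2) show False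
    by simp
qed

end
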